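(* Let $P,Q$ be integers and let $\Delta$, $S$, $\mathcal P_S$ be as defined in the context. The set $S$ is finite if and only if $\Delta=1$, in which case $S=\{1\}$. For $S$ infinite, $\mathcal P_S$ is finite when $Q=0$ and $P\ne0$, in which case $\mathcal P_S$ consists of the prime divisors of $P$. Otherwise (i.e. $S$ infinite and not both $Q=0$ and $P\neq 0$), $\mathcal P_S$ is also infinite. Furthermore, $\mathcal P_S$ is the set $\mathcal P$ of all primes if and only if every prime divisor of $Q$ is special. (This includes the case $Q=\pm1$.)
   Context: For integers $P,Q$, put $\Delta=P^2-4Q$. The Lucas sequence of the first kind $(u_n)_{n\ge0}$ is given by $u_0=0$, $u_1=1$, $u_{n+2}=Pu_{n+1}-Qu_n$ for $n\ge0$. Let $S=S(P,Q)$ be the set of all integers $n\ge1$ such that $n$ divides $u_n$ (every positive integer divides $0$). Let $\mathcal P_S$ be the set of primes $p$ that divide some $n\in S$. A prime is special if it divides both $P$ and $Q$. *)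

theory Defs
  imports Complex_Main "HOL-Computational_Algebra.Primes"
begin

fun lucas_u :: "int \<Rightarrow> int \<Rightarrow> nat \<Rightarrow> int" where
  "lucas_u P Q 0 = 0"
| "lucas_u P Q (Suc 0) = 1"
| "lucas_u P Q (Suc (Suc n)) = P * lucas_u P Q (Suc n) - Q * lucas_u P Q n"

definition lucas_disc :: "int \<Rightarrow> int \<Rightarrow> int" where
  "lucas_disc P Q = P ^ 2 - 4 * Q"

definition lucas_S :: "int \<Rightarrow> int \<Rightarrow> nat set" where
  "lucas_S P Q = {n. n \<ge> 1 \<and> int n dvd lucas_u P Q n}"

definition lucas_PS :: "int \<Rightarrow> int \<Rightarrow> nat set" where
  "lucas_PS P Q = {p. prime p \<and> (\<exists>n \<in> lucas_S P Q. p dvd n)}"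

definition special_prime :: "int \<Rightarrow> int \<Rightarrow> nat \<Rightarrow> bool" where
  "special_prime P Q p \<longleftrightarrow> prime p \<and> int p dvd P \<and> int p dvd Q"

end

theory Submission
  imports Defs "HOL-Number_Theory.Number_Theory" "HOL-Real_Asymp.Real_Asymp"
begin

text \<open>
  If $n \in S$ and a prime $p$ divides $\Delta u_n$, then $np \in S$. Hence $S$ is infinite as soon as
  some prime divides $\Delta$, that is, unless $\Delta = 1$; in that case
  $u_n = (k+1)^n - k^n$, and Fermat's theorem for the least prime factor of $n$ leaves only $n = 1$.

  A prime $p$ dividing $Q$ is in $\mathcal P_S$ iff it is special, since $u_n \equiv P^{n-1}$ modulo $Q$.
  A prime $p > 2$ not dividing $Q\Delta$ divides $u_{p-1}$ or $u_{p+1}$, and all prime factors of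
  $p \pm 1$ are smaller than $p$, so if every prime divisor of $Q$ is special, all primes are in
  $\mathcal P_S$ by induction.

  Otherwise some prime divides $Q$ but not $P$. Write $P^2 = da$ and $Q = db$ with $a, b$ coprime, so
  that $|b| \ge 2$ and $u_n^2 = d^{n-1} t_n$, where $t_n$ is the square of a Lehmer number for $(a,b)$.
  If $\mathcal P_S$ were finite, some $n \in S$ would be such that $t_n$ is divisible by all primes
  dividing any $t_m$ with $m \in S$. Taking $p \in S$ prime with $p \mid n$, the quotients
  $t_{np^{k+1}} / t_{np^k}$ then have no prime factor other than $p$, with exponent at most $2$ for
  large $k$. This bounds them by $p^2$, which is incompatible with the growth of $b^{np^k}$.
\<close>

subsection \<open>Squares of Lehmer numbers\<close>

text \<open>For $(\alpha + \beta)^2 = a$ and $\alpha\beta = b$ this is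
  $((\alpha^n - \beta^n) / (\alpha - \beta))^2$, which is an integer even when $\alpha + \beta$ is not.\<close>
fun lehmer_sq :: "int \<Rightarrow> int \<Rightarrow> nat \<Rightarrow> int" where
  "lehmer_sq a b 0 = 0"
| "lehmer_sq a b (Suc 0) = 1"
| "lehmer_sq a b (Suc (Suc n)) =
     (a - 2 * b) * lehmer_sq a b (Suc n) - b\<^sup>2 * lehmer_sq a b n + 2 * b ^ Suc n"

text \<open>One step of the recurrence sends (x, y) to (P x - Q y, x), which multiplies the
  quadratic form x^2 - P x y + Q y^2 by Q.\<close>

lemma lucas_u_cassini:
  "(lucas_u P Q (Suc n))\<^sup>2 - P * lucas_u P Q (Suc n) * lucas_u P Q n + Q * (lucas_u P Q n)\<^sup>2 = Q ^ n"
proof (induction n)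
  case (Suc n)
  have "(lucas_u P Q (Suc (Suc n)))\<^sup>2 - P * lucas_u P Q (Suc (Suc n)) * lucas_u P Q (Suc n)
          + Q * (lucas_u P Q (Suc n))\<^sup>2
      = Q * ((lucas_u P Q (Suc n))\<^sup>2 - P * lucas_u P Q (Suc n) * lucas_u P Q n + Q * (lucas_u P Q n)\<^sup>2)"
    by (simp add: power2_eq_square algebra_simps)
  then show ?case
    using Suc by simp
qed simp

text \<open>Squaring the recurrence leaves a mixed term in u_{n+1} u_n; Cassini's identity trades it
  for squares and the inhomogeneous term 2 Q^(n+1).\<close>

lemma lucas_u_sq: "(lucas_u P Q n)\<^sup>2 = lehmer_sq (P\<^sup>2) Q n"
proof (induction n rule: induct_nat_012)
  case (ge2 n)
  have "lehmer_sq (P\<^sup>2) Q (Suc (Suc n)) =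
      (P\<^sup>2 - 2 * Q) * (lucas_u P Q (Suc n))\<^sup>2 - Q\<^sup>2 * (lucas_u P Q n)\<^sup>2
      + 2 * Q * ((lucas_u P Q (Suc n))\<^sup>2 - P * lucas_u P Q (Suc n) * lucas_u P Q n + Q * (lucas_u P Q n)\<^sup>2)"
    unfolding lucas_u_cassini using ge2 by simp
  also have "\<dots> = (lucas_u P Q (Suc (Suc n)))\<^sup>2"
    by (simp add: power2_eq_square algebra_simps)
  finally show ?case ..
qed simp_all

text \<open>Homogeneity of degree n - 1 in the parameters; the extra factor d on the left keeps n =
  0 uniform. It serves to strip a common factor from P^2 and Q.\<close>

lemma lehmer_sq_scale: "d * lehmer_sq (d * a) (d * b) n = d ^ n * lehmer_sq a b n"
proof (induction a b n rule: lehmer_sq.induct)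
  case (3 a b n)
  have "d * lehmer_sq (d * a) (d * b) (Suc (Suc n)) =
      d * (a - 2 * b) * (d * lehmer_sq (d * a) (d * b) (Suc n))
      - d\<^sup>2 * b\<^sup>2 * (d * lehmer_sq (d * a) (d * b) n) + 2 * d * (d * b) ^ Suc n"
    by (simp add: algebra_simps power2_eq_square)
  also have "\<dots> = d ^ Suc (Suc n) * lehmer_sq a b (Suc (Suc n))"
    unfolding 3 by (simp add: algebra_simps power2_eq_square)
  finally show ?case .
qed simp_all

text \<open>Modulo a - 4b the two roots coincide: with a = 4b the recurrence is solved by n^2
  b^(n-1).\<close>

lemma lehmer_sq_cong_disc:
  "[lehmer_sq a b (Suc n) = int (Suc n) ^ 2 * b ^ n] (mod (a - 4 * b))"
proof -
  let ?D = "a - 4 * b"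
  have ab: "[a = 4 * b] (mod ?D)"
    by (simp add: cong_iff_dvd_diff)
  have "[lehmer_sq a b (Suc n) = int (Suc n) ^ 2 * b ^ n] (mod ?D) \<and>
        [lehmer_sq a b (Suc (Suc n)) = int (Suc (Suc n)) ^ 2 * b ^ Suc n] (mod ?D)"
  proof (induction n)
    case 0
    show ?case
      using ab by simp
  next
    case (Suc n)
    have "[lehmer_sq a b (Suc (Suc (Suc n))) =
       (4 * b - 2 * b) * (int (Suc (Suc n)) ^ 2 * b ^ Suc n)
       - b\<^sup>2 * (int (Suc n) ^ 2 * b ^ n) + 2 * b ^ Suc (Suc n)] (mod ?D)"
      unfolding lehmer_sq.simps(3)[of a b "Suc n"]
      by (intro cong_add cong_diff cong_mult ab cong_refl) (use Suc in auto)
    also have "(4 * b - 2 * b) * (int (Suc (Suc n)) ^ 2 * b ^ Suc n)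
       - b\<^sup>2 * (int (Suc n) ^ 2 * b ^ n) + 2 * b ^ Suc (Suc n) = int (Suc (Suc (Suc n))) ^ 2 * b ^ Suc (Suc n)"
      by (simp add: algebra_simps power2_eq_square)
    finally show ?case
      using Suc by blast
  qed
  then show ?thesis ..
qed

lemma lehmer_sq_cong_b: "[lehmer_sq a b (Suc n) = a ^ n] (mod b)"
proof (induction n)
  case (Suc n)
  have "[lehmer_sq a b (Suc (Suc n)) = a * lehmer_sq a b (Suc n)] (mod b)"
    by (simp add: cong_iff_dvd_diff algebra_simps power2_eq_square)
  also have "[a * lehmer_sq a b (Suc n) = a * a ^ n] (mod b)"
    using Suc by (intro cong_mult) auto
  finally show ?case
    by simp
qed simp

text \<open>Since (a - 4b) t_n + 2 b^n = \<alpha>^(2n) + \<beta>^(2n), this is the defining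
  recurrence taken along steps of length n.\<close>

lemma lehmer_sq_add:
  "lehmer_sq a b (m + 2 * n) + b ^ (2 * n) * lehmer_sq a b m =
   ((a - 4 * b) * lehmer_sq a b n + 2 * b ^ n) * lehmer_sq a b (m + n)
   + 2 * b ^ (m + n) * lehmer_sq a b n"
proof (induction n arbitrary: m rule: less_induct)
  case (less n)
  consider "n = 0" | "n = 1" | k where "n = Suc (Suc k)"
    by (metis One_nat_def not0_implies_Suc)
  then show ?case
  proof cases
    case 1
    then show ?thesis by simp
  next
    case 2
    then show ?thesis by (simp add: algebra_simps power2_eq_square)
  next
    case 3
    let ?t = "lehmer_sq a b"
    have e1: "?t (m + 2 * n) = (a - 2 * b) * ?t (Suc m + 2 * Suc k) - b\<^sup>2 * ?t (Suc (Suc m) + 2 * k)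
        + 2 * b ^ (m + 2 * k + 3)"
      using 3 by (simp add: numeral_eq_Suc)
    have e2: "b ^ (2 * n) * ?t m = b ^ (2 * Suc k) * (b\<^sup>2 * ?t m)"
      using 3 by (simp add: power2_eq_square power_add algebra_simps)
    have e3: "b\<^sup>2 * ?t m = (a - 2 * b) * ?t (Suc m) - ?t (Suc (Suc m)) + 2 * b ^ Suc m"
      by simp
    have e4: "b ^ (2 * n) * ?t m = (a - 2 * b) * (b ^ (2 * Suc k) * ?t (Suc m))
        - b\<^sup>2 * (b ^ (2 * k) * ?t (Suc (Suc m))) + 2 * b ^ (m + 2 * k + 3)"
      unfolding e2 e3 by (simp add: algebra_simps power2_eq_square power_add numeral_eq_Suc)
    \<comment> \<open>The induction hypotheses for n - 1 at m + 1 and for n - 2 at m + 2 share the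
      middle index m + n, so they combine by the recurrence in n.\<close>
    have i1: "?t (Suc m + 2 * Suc k) + b ^ (2 * Suc k) * ?t (Suc m) =
      ((a - 4 * b) * ?t (Suc k) + 2 * b ^ Suc k) * ?t (m + n) + 2 * b ^ (m + n) * ?t (Suc k)"
      using less.IH[of "Suc k" "Suc m"] 3 by simp
    have i2: "?t (Suc (Suc m) + 2 * k) + b ^ (2 * k) * ?t (Suc (Suc m)) =
      ((a - 4 * b) * ?t k + 2 * b ^ k) * ?t (m + n) + 2 * b ^ (m + n) * ?t k"
      using less.IH[of "k" "Suc (Suc m)"] 3 by simp
    have tn: "?t n = (a - 2 * b) * ?t (Suc k) - b\<^sup>2 * ?t k + 2 * b ^ Suc k"
      using 3 by simp
    have "?t (m + 2 * n) + b ^ (2 * n) * ?t m =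
       (a - 2 * b) * (?t (Suc m + 2 * Suc k) + b ^ (2 * Suc k) * ?t (Suc m))
       - b\<^sup>2 * (?t (Suc (Suc m) + 2 * k) + b ^ (2 * k) * ?t (Suc (Suc m))) + 4 * b ^ (m + 2 * k + 3)"
      unfolding e1 e4 by (simp add: algebra_simps)
    also have "\<dots> = (a - 2 * b) * (((a - 4 * b) * ?t (Suc k) + 2 * b ^ Suc k) * ?t (m + n) + 2 * b ^ (m + n) * ?t (Suc k))
      - b\<^sup>2 * (((a - 4 * b) * ?t k + 2 * b ^ k) * ?t (m + n) + 2 * b ^ (m + n) * ?t k) + 4 * (b ^ (m + n) * b ^ Suc k)"
      unfolding i1 i2 using 3 by (simp add: power_add algebra_simps numeral_eq_Suc)
    also have "\<dots> = ((a - 4 * b) * ?t n + 2 * b ^ n) * ?t (m + n) + 2 * b ^ (m + n) * ?t n"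
      unfolding tn unfolding 3 by (simp add: algebra_simps power2_eq_square)
    finally show ?thesis .
  qed
qed

text \<open>With $a = (\alpha + \beta)^2$ and $b = \alpha\beta$, the first argument on the right is
  $(\alpha^n + \beta^n)^2$.\<close>
lemma lehmer_sq_mult:
  "lehmer_sq a b (n * m) =
   lehmer_sq a b n * lehmer_sq ((a - 4 * b) * lehmer_sq a b n + 4 * b ^ n) (b ^ n) m"
proof (induction m rule: induct_nat_012)
  case (ge2 m)
  have "lehmer_sq a b (n * Suc (Suc m)) =
      ((a - 4 * b) * lehmer_sq a b n + 2 * b ^ n) * lehmer_sq a b (n * Suc m)
      + 2 * b ^ (n * Suc m) * lehmer_sq a b n - b ^ (2 * n) * lehmer_sq a b (n * m)"
  proof -
    have "n * Suc (Suc m) = n * m + 2 * n" "n * Suc m = n * m + n"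
      by simp_all
    then show ?thesis
      by (simp only: eq_diff_eq lehmer_sq_add)
  qed
  moreover have "b ^ (n * Suc m) = (b ^ n) ^ Suc m" "b ^ (2 * n) = (b ^ n)\<^sup>2"
    by (simp_all only: power_mult mult.commute[of 2])
  moreover have "((a - 4 * b) * T + 2 * B) * (T * y) + 2 * B ^ Suc m * T - B\<^sup>2 * (T * x) =
      T * (((a - 4 * b) * T + 4 * B - 2 * B) * y - B\<^sup>2 * x + 2 * B ^ Suc m)" for T B x y
    by (simp add: algebra_simps)
  ultimately show ?case
    by (simp only: ge2 lehmer_sq.simps(3))
qed simp_all

text \<open>The deviation from the double-root value obeys the same recurrence with a forcing term
  proportional to a - 4b, and |a - 2b| <= 3|b| keeps its growth under control.\<close>

lemma lehmer_sq_near_disc_zero: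
  "\<exists>C\<ge>0. \<forall>a b. \<bar>a - 4 * b\<bar> \<le> \<bar>b\<bar> \<longrightarrow>
     \<bar>lehmer_sq a b (Suc (Suc m)) - int (Suc (Suc m)) ^ 2 * b ^ Suc m\<bar> \<le> C * \<bar>a - 4 * b\<bar> * \<bar>b\<bar> ^ m"
proof -
  let ?e = "\<lambda>a b m. lehmer_sq a b (Suc m) - int (Suc m) ^ 2 * b ^ m"
  have rec: "?e a b (Suc (Suc m)) = ((a - 4 * b) + 2 * b) * ?e a b (Suc m) - b\<^sup>2 * ?e a b m
      + (a - 4 * b) * (int (Suc (Suc m)) ^ 2 * b ^ Suc m)" for a b m
    by (simp add: algebra_simps power2_eq_square)
  \<comment> \<open>Two consecutive deviations are bounded together; the factor |b| on the earlier
    one avoids the exponent m - 1.\<close>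
  have "\<exists>C\<ge>0. \<exists>C'\<ge>0. \<forall>a b. \<bar>a - 4 * b\<bar> \<le> \<bar>b\<bar> \<longrightarrow>
     \<bar>b\<bar> * \<bar>?e a b m\<bar> \<le> C' * \<bar>a - 4 * b\<bar> * \<bar>b\<bar> ^ m \<and>
     \<bar>?e a b (Suc m)\<bar> \<le> C * \<bar>a - 4 * b\<bar> * \<bar>b\<bar> ^ m"
  proof (induction m)
    case 0
    show ?case
      by (intro exI[of _ 1] conjI exI[of _ 0]) auto
  next
    case (Suc m)
    then obtain C C' where C: "C \<ge> 0" "C' \<ge> 0" and
      H': "\<And>a b. \<bar>a - 4 * b\<bar> \<le> \<bar>b\<bar> \<Longrightarrow> \<bar>b\<bar> * \<bar>?e a b m\<bar> \<le> C' * \<bar>a - 4 * b\<bar> * \<bar>b\<bar> ^ m" and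
      H: "\<And>a b. \<bar>a - 4 * b\<bar> \<le> \<bar>b\<bar> \<Longrightarrow> \<bar>?e a b (Suc m)\<bar> \<le> C * \<bar>a - 4 * b\<bar> * \<bar>b\<bar> ^ m"
      by blast
    define K where "K = 3 * C + C' + int (Suc (Suc m)) ^ 2"
    have "\<bar>b\<bar> * \<bar>?e a b (Suc m)\<bar> \<le> C * \<bar>a - 4 * b\<bar> * \<bar>b\<bar> ^ Suc m \<and>
          \<bar>?e a b (Suc (Suc m))\<bar> \<le> K * \<bar>a - 4 * b\<bar> * \<bar>b\<bar> ^ Suc m"
      if ab: "\<bar>a - 4 * b\<bar> \<le> \<bar>b\<bar>" for a b
    proof
      show "\<bar>b\<bar> * \<bar>?e a b (Suc m)\<bar> \<le> C * \<bar>a - 4 * b\<bar> * \<bar>b\<bar> ^ Suc m"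
        using mult_left_mono[OF H[OF ab], of "\<bar>b\<bar>"] by (simp add: mult_ac)
      have "\<bar>?e a b (Suc (Suc m))\<bar> \<le> \<bar>((a - 4 * b) + 2 * b) * ?e a b (Suc m)\<bar> + \<bar>b\<^sup>2 * ?e a b m\<bar>
         + \<bar>(a - 4 * b) * (int (Suc (Suc m)) ^ 2 * b ^ Suc m)\<bar>"
        unfolding rec by linarith
      moreover have "\<bar>((a - 4 * b) + 2 * b) * ?e a b (Suc m)\<bar> \<le> (3 * \<bar>b\<bar>) * (C * \<bar>a - 4 * b\<bar> * \<bar>b\<bar> ^ m)"
        unfolding abs_mult using ab H[OF ab] by (intro mult_mono) auto
      moreover have "\<bar>b\<^sup>2 * ?e a b m\<bar> \<le> \<bar>b\<bar> * (C' * \<bar>a - 4 * b\<bar> * \<bar>b\<bar> ^ m)"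
        using mult_left_mono[OF H'[OF ab], of "\<bar>b\<bar>"] by (simp add: abs_mult power2_eq_square mult_ac)
      moreover have "\<bar>(a - 4 * b) * (int (Suc (Suc m)) ^ 2 * b ^ Suc m)\<bar> =
          int (Suc (Suc m)) ^ 2 * \<bar>a - 4 * b\<bar> * \<bar>b\<bar> ^ Suc m"
        by (simp add: abs_mult power_abs)
      ultimately show "\<bar>?e a b (Suc (Suc m))\<bar> \<le> K * \<bar>a - 4 * b\<bar> * \<bar>b\<bar> ^ Suc m"
        unfolding K_def by (simp add: algebra_simps)
    qed
    moreover have "K \<ge> 0"
      using C unfolding K_def by simp
    ultimately show ?case
      using C by blast
  qed
  then show ?thesis
    by blast
qed

subsection \<open>Closure properties of the index set\<close>

lemma lucas_u_cong_Q: "[lucas_u P Q (Suc n) = P ^ n] (mod Q)"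
proof (induction n)
  case (Suc n)
  have "[lucas_u P Q (Suc (Suc n)) = P * lucas_u P Q (Suc n)] (mod Q)"
    by (simp add: cong_iff_dvd_diff)
  also have "[P * lucas_u P Q (Suc n) = P * P ^ n] (mod Q)"
    using Suc by (intro cong_mult) auto
  finally show ?case
    by simp
qed simp

text \<open>The new first parameter is the companion number v_n = \<alpha>^n + \<beta>^n, whose
  square is \<Delta> u_n^2 + 4 Q^n. The squared form follows from \<open>lehmer_sq_mult\<close> and
  suffices for divisibility.\<close>

lemma lucas_u_sq_mult:
  "(lucas_u P Q (n * m))\<^sup>2 =
   (lucas_u P Q n)\<^sup>2 * (lucas_u (2 * lucas_u P Q (Suc n) - P * lucas_u P Q n) (Q ^ n) m)\<^sup>2"
proof -
  have "(2 * lucas_u P Q (Suc n) - P * lucas_u P Q n)\<^sup>2 =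
      (P\<^sup>2 - 4 * Q) * (lucas_u P Q n)\<^sup>2 + 4 * Q ^ n"
    unfolding lucas_u_cassini[of P Q n, symmetric] by (simp add: power2_eq_square algebra_simps)
  then show ?thesis
    using lehmer_sq_mult[of "P\<^sup>2" Q n m] by (simp only: lucas_u_sq)
qed

lemma lucas_u_dvd_mult: "lucas_u P Q n dvd lucas_u P Q (n * m)"
proof -
  have "(lucas_u P Q n)\<^sup>2 dvd (lucas_u P Q (n * m))\<^sup>2"
    unfolding lucas_u_sq_mult by simp
  then show ?thesis
    by simp
qed

lemma prime_dvd_lucas_u_self:
  assumes "prime p" "int p dvd P\<^sup>2 - 4 * Q"
  shows "int p dvd lucas_u P Q p"
proof -
  obtain n where n: "p = Suc n"
    using assms(1) by (metis not_prime_0 not0_implies_Suc)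
  have "[lehmer_sq (P\<^sup>2) Q p = int p ^ 2 * Q ^ n] (mod int p)"
    using lehmer_sq_cong_disc[of "P\<^sup>2" Q n] assms(2) n cong_dvd_modulus by blast
  then have "int p dvd (lucas_u P Q p)\<^sup>2"
    unfolding lucas_u_sq by (subst cong_dvd_iff) auto
  then show ?thesis
    using assms(1) prime_dvd_power_int prime_nat_int_transfer by blast
qed

lemma lucas_S_pos: "n \<in> lucas_S P Q \<Longrightarrow> n > 0"
  by (simp add: lucas_S_def)

lemma one_in_lucas_S: "1 \<in> lucas_S P Q"
  by (simp add: lucas_S_def)

text \<open>Up to sign, u_{np} is u_n times the p-th term of the Lucas sequence for v_n and Q^n.
  That sequence has discriminant \<Delta> u_n^2, so p divides this term, while n divides
  u_n.\<close>

lemma lucas_S_mult_prime: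
  assumes "n \<in> lucas_S P Q" "prime p" "int p dvd lucas_disc P Q * lucas_u P Q n"
  shows "n * p \<in> lucas_S P Q"
proof -
  define V where "V = 2 * lucas_u P Q (Suc n) - P * lucas_u P Q n"
  have "V\<^sup>2 - 4 * Q ^ n = lucas_disc P Q * lucas_u P Q n * lucas_u P Q n"
    unfolding lucas_u_cassini[of P Q n, symmetric] V_def lucas_disc_def
    by (simp add: power2_eq_square algebra_simps)
  then have "int p dvd V\<^sup>2 - 4 * Q ^ n"
    using assms(3) by simp
  then have "int p dvd lucas_u V (Q ^ n) p"
    using assms(2) prime_dvd_lucas_u_self by blast
  moreover have "int n dvd lucas_u P Q n"
    using assms(1) by (simp add: lucas_S_def)
  ultimately have "(int n * int p)\<^sup>2 dvd (lucas_u P Q (n * p))\<^sup>2"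
    unfolding lucas_u_sq_mult V_def[symmetric] power_mult_distrib by (intro mult_dvd_mono) auto
  then have "int (n * p) dvd lucas_u P Q (n * p)"
    by simp
  then show ?thesis
    using assms(1,2) by (simp add: lucas_S_def prime_gt_0_nat Suc_le_eq)
qed

lemma lucas_S_mult_prime_power:
  assumes "n \<in> lucas_S P Q" "prime p" "int p dvd lucas_disc P Q * lucas_u P Q n"
  shows "n * p ^ k \<in> lucas_S P Q"
proof (induction k)
  case (Suc k)
  have "int p dvd lucas_disc P Q * lucas_u P Q (n * p ^ k)"
    using assms(3) lucas_u_dvd_mult[of P Q n "p ^ k"] by (meson dvd_refl dvd_trans mult_dvd_mono)
  then show ?case
    using lucas_S_mult_prime[OF Suc assms(2)] by (simp add: mult_ac)
qed (use assms in simp)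

lemma lucas_S_lcm:
  assumes "m \<in> lucas_S P Q" "n \<in> lucas_S P Q"
  shows "lcm m n \<in> lucas_S P Q"
proof -
  have "int k dvd lucas_u P Q (lcm m n)" if "k \<in> lucas_S P Q" "k dvd lcm m n" for k
  proof -
    obtain l where "lcm m n = k * l"
      using \<open>k dvd lcm m n\<close> by blast
    then show ?thesis
      using that lucas_u_dvd_mult[of P Q k l] by (auto simp: lucas_S_def intro: dvd_trans)
  qed
  then have "int (lcm m n) dvd lucas_u P Q (lcm m n)"
    using assms by (simp flip: lcm_int_int_eq add: lcm_least)
  moreover have "lcm m n > 0"
    using assms[THEN lucas_S_pos] by (simp add: lcm_pos_nat)
  ultimately show ?thesis
    by (simp add: lucas_S_def)
qed

lemma prime_in_lucas_PS:
  assumes "prime p" "n \<in> lucas_S P Q" "int p dvd lucas_disc P Q * lucas_u P Q n"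
  shows "p \<in> lucas_PS P Q"
  using lucas_S_mult_prime[OF assms(2,1,3)] assms(1) by (auto simp: lucas_PS_def intro!: bexI[of _ "n * p"])

lemma lucas_S_multiple_exists:
  assumes "m > 0" "\<And>q. prime q \<Longrightarrow> q dvd m \<Longrightarrow> q \<in> lucas_PS P Q"
  shows "\<exists>n\<in>lucas_S P Q. m dvd n"
  using assms
proof (induction m rule: less_induct)
  case (less m)
  show ?case
  proof (cases "m = 1")
    case True
    then show ?thesis
      using one_in_lucas_S by auto
  next
    case False
    then obtain q m' where q: "prime q" "m = q * m'"
      using prime_factor_nat by blast
    then have "m' < m" "m' > 0"
      using less.prems(1) prime_gt_1_nat by fastforce+
    then obtain n where n: "n \<in> lucas_S P Q" "m' dvd n"
      using less q by (meson dvd_mult)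
    obtain n' where n': "n' \<in> lucas_S P Q" "q dvd n'"
      using less.prems(2)[of q] q by (auto simp: lucas_PS_def)
    define L where "L = lcm n n'"
    have L: "L \<in> lucas_S P Q" "q dvd L" "m' dvd L"
      using n n' lucas_S_lcm unfolding L_def by (auto intro: dvd_lcmI1 dvd_lcmI2)
    then have "int q dvd lucas_u P Q L"
      by (auto simp: lucas_S_def intro: dvd_trans[of "int q" "int L"])
    \<comment> \<open>\<open>L\<close> may contain q only as often as m' does; as q divides u_L, one
      more factor q can be added.\<close>
    then have "L * q \<in> lucas_S P Q"
      using L q lucas_S_mult_prime by simp
    then show ?thesis
      using L q by (metis mult.commute mult_dvd_mono dvd_refl)
  qed
qed

text \<open>Some multiple of m lies in S, and p still divides the Lucas number at that
  index.\<close>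

lemma prime_in_lucas_PS_if_dvd_lucas_u:
  assumes "prime p" "m > 0" "int p dvd lucas_u P Q m"
    and "\<And>q. prime q \<Longrightarrow> q dvd m \<Longrightarrow> q \<in> lucas_PS P Q"
  shows "p \<in> lucas_PS P Q"
proof -
  obtain l where "m * l \<in> lucas_S P Q"
    using lucas_S_multiple_exists[OF assms(2,4)] by blast
  moreover have "int p dvd lucas_u P Q (m * l)"
    using assms(3) lucas_u_dvd_mult dvd_trans by blast
  ultimately show ?thesis
    using assms(1) prime_in_lucas_PS by simp
qed

text \<open>Every u_n with n >= 2 is an integer combination of P and Q.\<close>

lemma special_prime_in_lucas_S:
  assumes "special_prime P Q p"
  shows "p \<in> lucas_S P Q"
proof -
  have p: "prime p" "int p dvd P" "int p dvd Q"
    using assms by (auto simp: special_prime_def)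
  obtain n where "p = Suc (Suc n)"
    using prime_ge_2_nat[OF p(1)] by (metis One_nat_def Suc_1 Suc_le_D Suc_le_mono)
  then show ?thesis
    using p by (simp add: lucas_S_def del: of_nat_Suc)
qed

lemma special_prime_if_in_lucas_PS:
  assumes "p \<in> lucas_PS P Q" "int p dvd Q"
  shows "special_prime P Q p"
proof -
  obtain n where n: "n \<in> lucas_S P Q" "p dvd n" and p: "prime p"
    using assms(1) by (auto simp: lucas_PS_def)
  obtain m where m: "n = Suc m"
    using lucas_S_pos[OF n(1)] by (metis gr0_implies_Suc)
  have "int p dvd lucas_u P Q (Suc m)"
    using n m dvd_trans[of "int p" "int n"] by (simp add: lucas_S_def del: of_nat_Suc)
  moreover have "[lucas_u P Q (Suc m) = P ^ m] (mod int p)"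
    using lucas_u_cong_Q assms(2) cong_dvd_modulus by blast
  ultimately have "int p dvd P ^ m"
    using cong_dvd_iff by blast
  then show ?thesis
    using p assms(2) prime_dvd_power_int[of "int p"] by (simp add: special_prime_def)
qed

subsection \<open>The rank of apparition\<close>

lemma fermat_theorem_int:
  fixes a :: int
  assumes "prime p" "\<not> int p dvd a"
  shows "[a ^ (p - 1) = 1] (mod int p)"
proof -
  define b where "b = nat (a mod int p)"
  have b: "int b = a mod int p"
    using assms(1) by (simp add: b_def prime_gt_0_nat)
  have ab: "[a = int b] (mod int p)"
    unfolding b by simp
  then have "\<not> p dvd b"
    using assms(2) cong_dvd_iff int_dvd_int_iff by blast
  then have "[int (b ^ (p - 1)) = int 1] (mod int p)"
    using fermat_theorem[OF assms(1)] cong_int_iff by blast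
  then show ?thesis
    using cong_pow[OF ab, of "p - 1"] cong_trans by fastforce
qed

lemma lucas_u_binet:
  fixes \<delta> :: complex
  assumes "\<delta>\<^sup>2 = of_int (P\<^sup>2 - 4 * Q)"
  shows "2 ^ n * \<delta> * of_int (lucas_u P Q n) = (\<delta> + of_int P) ^ n - (- \<delta> + of_int P) ^ n"
proof (induction n rule: induct_nat_012)
  case (ge2 n)
  have Q: "4 * of_int Q = (of_int P)\<^sup>2 - \<delta>\<^sup>2"
    using assms by simp
  have "2 ^ Suc (Suc n) * \<delta> * of_int (lucas_u P Q (Suc (Suc n))) =
      2 * of_int P * (2 ^ Suc n * \<delta> * of_int (lucas_u P Q (Suc n)))
      - 4 * of_int Q * (2 ^ n * \<delta> * of_int (lucas_u P Q n))"
    by (simp add: algebra_simps)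
  also have "\<dots> = (\<delta> + of_int P) ^ Suc (Suc n) - (- \<delta> + of_int P) ^ Suc (Suc n)"
    unfolding ge2 Q by (simp add: algebra_simps power2_eq_square)
  finally show ?case .
qed simp_all

text \<open>In Binet's formula even powers of \<delta> cancel and odd ones double; a nonzero
  discriminant allows \<delta> to be cancelled.\<close>

lemma lucas_u_binomial:
  assumes "P\<^sup>2 - 4 * Q \<noteq> 0"
  shows "2 ^ n * lucas_u P Q n =
    2 * (\<Sum>k\<le>n. int (n choose k) * (if odd k then (P\<^sup>2 - 4 * Q) ^ (k div 2) else 0) * P ^ (n - k))"
    (is "_ = 2 * (\<Sum>k\<le>n. ?f k)")
proof -
  define \<delta> where "\<delta> = csqrt (of_int (P\<^sup>2 - 4 * Q))"
  have \<delta>: "\<delta>\<^sup>2 = of_int (P\<^sup>2 - 4 * Q)" "\<delta> \<noteq> 0"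
    using assms by (simp_all add: \<delta>_def del: of_int_diff)
  have diff: "\<delta> ^ k - (- \<delta>) ^ k = 2 * \<delta> * of_int (if odd k then (P\<^sup>2 - 4 * Q) ^ (k div 2) else 0)" for k
  proof (cases "odd k")
    case True
    then obtain j where j: "k = 2 * j + 1"
      by (elim oddE)
    have "\<delta> ^ k = \<delta> * (\<delta>\<^sup>2) ^ j"
      by (simp add: j power_mult)
    also have "\<dots> = \<delta> * of_int ((P\<^sup>2 - 4 * Q) ^ j)"
      unfolding \<delta>(1) by (simp only: of_int_power)
    finally show ?thesis
      using True j by (simp add: power_minus_odd)
  qed simp
  have "2 ^ n * \<delta> * of_int (lucas_u P Q n) =
      (\<Sum>k\<le>n. of_nat (n choose k) * (\<delta> ^ k - (- \<delta>) ^ k) * of_int P ^ (n - k))"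
    unfolding lucas_u_binet[OF \<delta>(1)] binomial_ring by (simp add: sum_subtractf algebra_simps)
  also have "\<dots> = \<delta> * of_int (2 * (\<Sum>k\<le>n. ?f k))"
    unfolding diff of_int_mult of_int_sum sum_distrib_left by (intro sum.cong) (auto simp: mult_ac)
  finally have "\<delta> * of_int (2 ^ n * lucas_u P Q n) = \<delta> * of_int (2 * (\<Sum>k\<le>n. ?f k))"
    by (simp add: mult_ac)
  then show ?thesis
    using mult_left_cancel[OF \<delta>(2), THEN iffD1] of_int_eq_iff by blast
qed

text \<open>Modulo p only the summand k = p of the binomial formula survives, so u_p is
  \<Delta>^((p-1)/2), whose square is 1 by Fermat.\<close>

lemma lucas_u_prime_sq_cong_1:
  assumes "prime p" "odd p" "\<not> int p dvd P\<^sup>2 - 4 * Q"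
  shows "[(lucas_u P Q p)\<^sup>2 = 1] (mod int p)"
proof -
  let ?D = "P\<^sup>2 - 4 * Q" and ?u = "lucas_u P Q p"
  let ?f = "\<lambda>k. int (p choose k) * (if odd k then ?D ^ (k div 2) else 0) * P ^ (p - k)"
  have "?D \<noteq> 0"
    using assms(3) by auto
  have f: "[?f k = 0] (mod int p)" if "k < p" for k
  proof (cases "k = 0")
    case False
    then have "p dvd (p choose k)"
      using assms(1) that dvd_choose_prime[of k p] by auto
    then show ?thesis
      by (simp add: cong_0_iff)
  qed simp
  have "(\<Sum>k\<le>p. ?f k) = (\<Sum>k<p. ?f k) + ?D ^ (p div 2)"
    using assms(2) by (simp add: lessThan_Suc_atMost[symmetric])
  also have "[\<dots> = (\<Sum>k<p. 0) + ?D ^ (p div 2)] (mod int p)"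
    by (intro cong_add cong_sum cong_refl f) auto
  finally have "[2 * (\<Sum>k\<le>p. ?f k) = 2 * ?D ^ (p div 2)] (mod int p)"
    by (intro cong_mult) auto
  then have "[2 ^ p * ?u = 2 * ?D ^ (p div 2)] (mod int p)"
    unfolding lucas_u_binomial[OF \<open>?D \<noteq> 0\<close>] .
  moreover have two: "\<not> int p dvd 2"
    using assms(1,2) by (metis int_dvd_int_iff of_nat_numeral primes_dvd_imp_eq two_is_prime_nat even_numeral)
  have "[2 ^ p = 2] (mod int p)"
    using fermat_theorem_int[OF assms(1) two] assms(1)
    by (metis cong_scalar_left mult.right_neutral power_eq_if not_prime_0)
  then have "[2 ^ p * ?u = 2 * ?u] (mod int p)"
    by (intro cong_mult) auto
  ultimately have "[2 * ?u = 2 * ?D ^ (p div 2)] (mod int p)"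
    using cong_trans cong_sym by blast
  moreover have "coprime 2 (int p)"
    using assms(2) by simp
  ultimately have "[?u = ?D ^ (p div 2)] (mod int p)"
    using cong_mult_lcancel by blast
  then have "[?u\<^sup>2 = (?D ^ (p div 2))\<^sup>2] (mod int p)"
    by (rule cong_pow)
  also have "(?D ^ (p div 2))\<^sup>2 = ?D ^ (p - 1)"
    using assms(2) by (metis dvd_mult_div_cancel mult.commute odd_two_times_div_two_nat power_mult)
  also have "[?D ^ (p - 1) = 1] (mod int p)"
    using fermat_theorem_int assms by blast
  finally show ?thesis .
qed

text \<open>By Cassini's identity u_{p-1} u_{p+1} = u_p^2 - Q^(p-1), and both terms on the right are
  1 modulo p.\<close>

lemma prime_dvd_lucas_u_neighbour:
  assumes "prime p" "odd p" "\<not> int p dvd P\<^sup>2 - 4 * Q" "\<not> int p dvd Q"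
  shows "int p dvd lucas_u P Q (p - 1) \<or> int p dvd lucas_u P Q (p + 1)"
proof -
  obtain n where n: "p = Suc n"
    using assms(1) by (metis not_prime_0 not0_implies_Suc)
  have "[(lucas_u P Q p)\<^sup>2 - Q ^ (p - 1) = 1 - 1] (mod int p)"
    using lucas_u_prime_sq_cong_1[OF assms(1-3)] fermat_theorem_int[OF assms(1,4)] cong_diff by blast
  moreover have "(lucas_u P Q (Suc n))\<^sup>2 - Q ^ n = lucas_u P Q n * lucas_u P Q (Suc (Suc n))"
    unfolding lucas_u_cassini[of P Q n, symmetric] by (simp add: algebra_simps power2_eq_square)
  ultimately have "int p dvd lucas_u P Q n * lucas_u P Q (Suc (Suc n))"
    using n by (simp add: cong_0_iff del: lucas_u.simps of_nat_Suc)
  then show ?thesis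
    using assms(1) n by (simp add: prime_dvd_mult_iff del: lucas_u.simps of_nat_Suc)
qed

section \<open>All primes occur when every prime divisor of Q is special\<close>

lemma three_dvd_lucas_u_4:
  assumes "\<not> 3 dvd P\<^sup>2 - 4 * Q" "\<not> 3 dvd Q"
  shows "3 dvd lucas_u P Q 4"
proof -
  have "lucas_u P Q 4 = P * (P\<^sup>2 - 2 * Q)"
    by (simp add: numeral_eq_Suc algebra_simps)
  moreover have "3 dvd P\<^sup>2 - 2 * Q" if "\<not> 3 dvd P"
  proof -
    have "[P ^ (3 - 1) = 1] (mod int 3)"
      by (rule fermat_theorem_int) (use that in simp_all)
    then have "3 dvd P\<^sup>2 - 1"
      by (simp add: cong_iff_dvd_diff)
    \<comment> \<open>As P^2 is 1 modulo 3, Q can be neither 0 nor 1 there, so Q is 2.\<close>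
    then show ?thesis
      using assms by presburger
  qed
  ultimately show ?thesis
    by (metis dvd_mult dvd_mult2)
qed

lemma prime_in_lucas_S_in_lucas_PS: "prime p \<Longrightarrow> p \<in> lucas_S P Q \<Longrightarrow> p \<in> lucas_PS P Q"
  by (auto simp: lucas_PS_def intro!: bexI[of _ p])

text \<open>The ranks of apparition of 2 and 3 may be 3 and 4, so neither prime can be reached from the
  other one; then 12 belongs to the set instead.\<close>
lemma two_in_lucas_PS:
  assumes "\<And>p. prime p \<Longrightarrow> int p dvd Q \<Longrightarrow> special_prime P Q p"
  shows "2 \<in> lucas_PS P Q"
proof -
  consider "even Q" | "even P" | "odd P" "odd Q" by blast
  then show ?thesis
  proof cases
    case 1
    then have "2 \<in> lucas_S P Q"
      using assms[of 2] special_prime_in_lucas_S by simp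
    then show ?thesis
      by (intro prime_in_lucas_S_in_lucas_PS) simp_all
  next
    case 2
    then show ?thesis
      by (intro prime_in_lucas_PS[OF _ one_in_lucas_S]) (simp_all add: lucas_disc_def)
  next
    case 3
    have three: "prime (3::nat)"
      by simp
    have u3: "lucas_u P Q 3 = P\<^sup>2 - Q"
      by (simp add: numeral_eq_Suc power2_eq_square)
    show ?thesis
    proof (cases "3 dvd P\<^sup>2 - 4 * Q \<or> 3 dvd Q")
      case True
      then have "3 \<in> lucas_S P Q"
      proof
        assume "3 dvd P\<^sup>2 - 4 * Q"
        then have "1 * 3 \<in> lucas_S P Q"
          by (intro lucas_S_mult_prime one_in_lucas_S three) (simp add: lucas_disc_def)
        then show ?thesis by simp
      next
        assume "3 dvd Q"
        then show ?thesis
          using assms[of 3] three special_prime_in_lucas_S by simp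
      qed
      \<comment> \<open>Here u_3 = P^2 - Q is even because P and Q are odd.\<close>
      then show ?thesis
        by (rule prime_in_lucas_PS[rotated]) (use 3 u3 in simp_all)
    next
      case False
      have "lucas_u P Q 6 = (P\<^sup>2 - Q) * (P * (P\<^sup>2 - 3 * Q))"
        by (simp add: numeral_eq_Suc algebra_simps)
      \<comment> \<open>Both P^2 - Q and P^2 - 3Q are even, so 4 divides u_6 and with it u_12; the
        factor 3 comes from u_4.\<close>
      moreover have "2 * 2 dvd (P\<^sup>2 - Q) * (P * (P\<^sup>2 - 3 * Q))"
        using 3 by (intro mult_dvd_mono) simp_all
      ultimately have "4 dvd lucas_u P Q 12"
        using lucas_u_dvd_mult[of P Q 6 2] by (auto intro: dvd_trans)
      moreover have "3 dvd lucas_u P Q 12"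
        using lucas_u_dvd_mult[of P Q 4 3] three_dvd_lucas_u_4[of P Q] False by (auto intro: dvd_trans)
      ultimately have "12 dvd lucas_u P Q 12"
        by presburger
      then have "12 \<in> lucas_S P Q"
        by (simp add: lucas_S_def)
      then show ?thesis
        by (auto simp: lucas_PS_def intro!: bexI[of _ 12])
    qed
  qed
qed

lemma prime_in_lucas_PS_if_all_special:
  assumes "\<And>p. prime p \<Longrightarrow> int p dvd Q \<Longrightarrow> special_prime P Q p" and "prime p"
  shows "p \<in> lucas_PS P Q"
  using assms(2)
proof (induction p rule: less_induct)
  case (less p)
  consider "p = 2" | "int p dvd Q" | "int p dvd lucas_disc P Q" |
    "p \<noteq> 2" "\<not> int p dvd Q" "\<not> int p dvd P\<^sup>2 - 4 * Q"
    by (auto simp: lucas_disc_def)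
  then show ?case
  proof cases
    case 1
    then show ?thesis
      using two_in_lucas_PS[OF assms(1)] by blast
  next
    case 2
    then have "p \<in> lucas_S P Q"
      using assms(1) less.prems special_prime_in_lucas_S by blast
    then show ?thesis
      using less.prems prime_in_lucas_S_in_lucas_PS by blast
  next
    case 3
    then show ?thesis
      using less.prems by (intro prime_in_lucas_PS[OF _ one_in_lucas_S]) simp_all
  next
    case 4
    have p: "odd p" "p \<ge> 3"
      using 4(1) less.prems prime_odd_nat[of p] prime_ge_2_nat[of p] by fastforce+
    have "q < p" if q: "prime q" "q dvd p - 1 \<or> q dvd p + 1" for q
      using q(2)
    proof
      assume "q dvd p - 1"
      then show ?thesis
        using p dvd_imp_le[of q "p - 1"] by simp
    next
      assume *: "q dvd p + 1"
      have "q \<noteq> p"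
        using * q(1) by (metis dvd_add_triv_left_iff nat_dvd_1_iff_1 not_prime_1)
      \<comment> \<open>p + 1 is even and exceeds 2, hence is not prime.\<close>
      moreover have "q \<noteq> p + 1"
        using p q(1) prime_odd_nat[of q] by auto
      ultimately show ?thesis
        using dvd_imp_le[OF *] by simp
    qed
    then have IH: "q \<in> lucas_PS P Q" if "prime q" "q dvd p - 1 \<or> q dvd p + 1" for q
      using that less.IH by blast
    show ?thesis
      using prime_dvd_lucas_u_neighbour[OF less.prems p(1) 4(3,2)]
    proof
      assume "int p dvd lucas_u P Q (p - 1)"
      then show ?thesis
        using p IH by (intro prime_in_lucas_PS_if_dvd_lucas_u[OF less.prems, of "p - 1"]) simp_all
    next
      assume "int p dvd lucas_u P Q (p + 1)"
      then show ?thesis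
        using IH by (intro prime_in_lucas_PS_if_dvd_lucas_u[OF less.prems, of "p + 1"]) simp_all
    qed
  qed
qed

section \<open>Finiteness of the index set in terms of the discriminant\<close>

lemma prime_dvd_lucas_disc_in_lucas_S:
  assumes "lucas_disc P Q \<noteq> 1"
  obtains p where "prime p" "int p dvd lucas_disc P Q" "p \<in> lucas_S P Q"
proof -
  \<comment> \<open>The discriminant is a square modulo 4, so it is never -1; being different from 1
    as well, it is not a unit.\<close>
  have "lucas_disc P Q \<noteq> - 1"
  proof
    assume "lucas_disc P Q = - 1"
    then have "P\<^sup>2 mod 4 = 3"
      unfolding lucas_disc_def by presburger
    moreover have "P mod 4 = 0 \<or> P mod 4 = 1 \<or> P mod 4 = 2 \<or> P mod 4 = 3"
      by presburger
    ultimately show False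
      using power_mod[of P 4 2] by auto
  qed
  then obtain p' :: int where p': "prime p'" "p' dvd lucas_disc P Q"
    using assms prime_factor_int[of "lucas_disc P Q"] by (metis abs_eq_iff' abs_one)
  define p where "p = nat p'"
  have p: "prime p" "int p dvd lucas_disc P Q"
    using p' by (simp_all add: p_def prime_nat_iff_prime prime_ge_0_int)
  then have "1 * p \<in> lucas_S P Q"
    by (intro lucas_S_mult_prime one_in_lucas_S) simp_all
  then show ?thesis
    using that p by simp
qed

lemma infinite_lucas_S:
  assumes "lucas_disc P Q \<noteq> 1"
  shows "infinite (lucas_S P Q)"
proof -
  obtain p where p: "prime p" "int p dvd lucas_disc P Q"
    using prime_dvd_lucas_disc_in_lucas_S[OF assms] by blast
  have "1 * p ^ k \<in> lucas_S P Q" for k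
    by (intro lucas_S_mult_prime_power one_in_lucas_S) (use p in simp_all)
  then have "range (\<lambda>k. p ^ k) \<subseteq> lucas_S P Q"
    by auto
  moreover have "inj (\<lambda>k. p ^ k)"
    using p(1) prime_gt_1_nat[of p] by (intro injI) (simp add: power_inject_exp)
  ultimately show ?thesis
    using finite_subset range_inj_infinite by blast
qed

lemma lucas_S_disc_1:
  assumes "lucas_disc P Q = 1"
  shows "lucas_S P Q = {1}"
proof -
  have "odd P"
  proof
    assume "even P"
    then have "even (lucas_disc P Q)"
      by (simp add: lucas_disc_def)
    then show False
      using assms by simp
  qed
  then obtain k where P: "P = 2 * k + 1"
    by (elim oddE)
  have Q: "Q = k * (k + 1)"
    using assms unfolding lucas_disc_def P by (simp add: power2_eq_square algebra_simps)
  \<comment> \<open>Discriminant 1 means that the roots are k and k + 1.\<close>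
  have u: "lucas_u P Q n = (k + 1) ^ n - k ^ n" for n
  proof (induction n rule: induct_nat_012)
    case (ge2 n)
    then show ?case
      unfolding lucas_u.simps(3) ge2 by (simp add: P Q algebra_simps)
  qed simp_all
  have "n = 1" if n: "n \<in> lucas_S P Q" for n
  proof (rule ccontr)
    assume "n \<noteq> 1"
    define p where "p = (LEAST p. prime p \<and> p dvd n)"
    have p: "prime p" "p dvd n"
      using LeastI_ex[OF prime_factor_nat[OF \<open>n \<noteq> 1\<close>]] by (simp_all add: p_def)
    have least: "p \<le> q" if "prime q" "q dvd n" for q
      unfolding p_def using that by (simp add: Least_le)
    have "gcd n (p - 1) = 1"
    proof (rule ccontr)
      assume "gcd n (p - 1) \<noteq> 1"
      then obtain q where q: "prime q" "q dvd n" "q dvd p - 1"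
        using prime_factor_nat by (metis gcd_greatest_iff)
      then show False
        using least[OF q(1,2)] dvd_imp_le[OF q(3)] prime_gt_1_nat[OF p(1)] by simp
    qed
    \<comment> \<open>By Fermat, raising to the power n x fixes all residues prime to p, so equal
      n-th powers of k and k + 1 will force k + 1 = k modulo p.\<close>
    then obtain x y where xy: "n * x = (p - 1) * y + 1"
      using bezout_nat[of n "p - 1"] lucas_S_pos[OF n] by auto
    have "int p dvd (k + 1) ^ n - k ^ n"
      using n p(2) dvd_trans[of "int p" "int n"] by (simp add: lucas_S_def u)
    then have eq: "[(k + 1) ^ n = k ^ n] (mod int p)"
      by (simp add: cong_iff_dvd_diff)
    have "\<not> int p dvd k \<and> \<not> int p dvd k + 1"
    proof -
      \<comment> \<open>If p divided one of the two, the congruence of n-th powers would make it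
        divide the other, hence also 1.\<close>
      have "int p dvd k \<longleftrightarrow> int p dvd k + 1"
        using cong_dvd_iff[OF eq] lucas_S_pos[OF n] p(1)
        by (metis prime_dvd_power_int prime_nat_int_transfer dvd_power_same dvd_trans dvd_power)
      moreover have "\<not> (int p dvd k \<and> int p dvd k + 1)"
        using p(1) by (metis dvd_add_right_iff int_dvd_int_iff nat_dvd_1_iff_1 not_prime_1 of_nat_1)
      ultimately show ?thesis by blast
    qed
    moreover have "[z ^ (n * x) = z] (mod int p)" if "\<not> int p dvd z" for z
    proof -
      have "[(z ^ (p - 1)) ^ y * z = 1 ^ y * z] (mod int p)"
        using fermat_theorem_int[OF p(1) that] by (intro cong_mult cong_pow) simp_all
      then show ?thesis
        by (simp only: xy power_add power_mult power_one_right power_one mult_1)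
    qed
    moreover have "[(k + 1) ^ (n * x) = k ^ (n * x)] (mod int p)"
      unfolding power_mult by (rule cong_pow[OF eq])
    ultimately have "[k + 1 = k] (mod int p)"
      using cong_trans cong_sym by meson
    then have "int p dvd 1"
      by (simp add: cong_iff_dvd_diff)
    then show False
      using p(1) by simp
  qed
  then show ?thesis
    using one_in_lucas_S by blast
qed

subsection \<open>Growth\<close>

lemma square_lt_exp_at_power:
  assumes "p > (1::nat)"
  shows "\<exists>k. K * int (p ^ k) ^ 2 < 2 ^ (p ^ k)"
proof -
  define K' :: real where "K' = real_of_int (max K 1)"
  have "K' > 0"
    by (simp add: K'_def)
  then have "eventually (\<lambda>y::nat. K' * real y ^ 2 < 2 ^ y) at_top"
    by real_asymp
  then obtain Y where Y: "\<And>y. y \<ge> Y \<Longrightarrow> K' * real y ^ 2 < 2 ^ y"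
    by (auto simp: eventually_at_top_linorder)
  \<comment> \<open>The threshold itself serves as exponent.\<close>
  have "Y \<le> p ^ Y"
    using power_gt_expt[of p Y] assms by simp
  then have "real_of_int (max K 1 * int (p ^ Y) ^ 2) < real_of_int (2 ^ (p ^ Y))"
    using Y[of "p ^ Y"] by (simp add: K'_def)
  then have "max K 1 * int (p ^ Y) ^ 2 < 2 ^ (p ^ Y)"
    by (simp only: of_int_less_iff)
  moreover have "K * int (p ^ Y) ^ 2 \<le> max K 1 * int (p ^ Y) ^ 2"
    by (intro mult_right_mono) simp_all
  ultimately show ?thesis
    by (intro exI[of _ Y]) linarith
qed

text \<open>If all the quotients were at most $p^2$, the discriminants would grow at most like $p^{2k}$,
  much more slowly than $b^{n p^k}$; the quotient would then be close to its value $p^2 B^{p-1}$ at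
  discriminant $0$, where $B = b^{n p^k}$.\<close>
lemma lehmer_sq_quotient_large:
  assumes p: "p > 1" and n: "n > 0" and b: "\<bar>b\<bar> \<ge> 2" and m: "m = (\<lambda>k. n * p ^ k)"
  shows "\<exists>k. \<bar>lehmer_sq ((a - 4 * b) * lehmer_sq a b (m k) + 4 * b ^ m k) (b ^ m k) p\<bar> > int p ^ 2"
proof (rule ccontr)
  let ?D = "\<lambda>k. (a - 4 * b) * lehmer_sq a b (m k)"
  let ?\<tau> = "\<lambda>k. lehmer_sq (?D k + 4 * b ^ m k) (b ^ m k) p"
  assume "\<not> ?thesis"
  then have \<tau>: "\<bar>?\<tau> k\<bar> \<le> int p ^ 2" for k
    by (simp add: not_less)
  \<comment> \<open>Passing from k to k + 1 multiplies \<open>?D k\<close> by the quotient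
    \<open>?\<tau> k\<close>, assumed to be at most p^2 in absolute value.\<close>
  have D: "\<bar>?D k\<bar> \<le> \<bar>?D 0\<bar> * int (p ^ k) ^ 2" for k
  proof (induction k)
    case (Suc k)
    have "lehmer_sq a b (m (Suc k)) = lehmer_sq a b (m k) * ?\<tau> k"
      using lehmer_sq_mult[of a b "m k" p] by (simp add: m mult_ac)
    then have "\<bar>?D (Suc k)\<bar> = \<bar>?D k\<bar> * \<bar>?\<tau> k\<bar>"
      by (simp only: abs_mult mult.assoc)
    also have "\<dots> \<le> (\<bar>?D 0\<bar> * int (p ^ k) ^ 2) * int p ^ 2"
      using Suc \<tau>[of k] by (intro mult_mono) simp_all
    finally show ?case
      by (simp add: power_mult_distrib mult_ac)
  qed simp
  obtain q where q: "p = Suc (Suc q)"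
    using less_imp_Suc_add[OF p] by auto
  obtain C where C: "C \<ge> 0" "\<And>a b. \<bar>a - 4 * b\<bar> \<le> \<bar>b\<bar> \<Longrightarrow>
     \<bar>lehmer_sq a b p - int p ^ 2 * b ^ Suc q\<bar> \<le> C * \<bar>a - 4 * b\<bar> * \<bar>b\<bar> ^ q"
    using lehmer_sq_near_disc_zero[of q] q by blast
  \<comment> \<open>The constant C + 1 makes |B| dominate both \<open>?D k\<close>, so that the
    estimate near discriminant 0 applies, and C times it, so that the error is at most
    |B|^(p-1).\<close>
  obtain k where k: "((C + 1) * \<bar>?D 0\<bar>) * int (p ^ k) ^ 2 < 2 ^ (p ^ k)"
    using square_lt_exp_at_power[OF p] by blast
  define B where "B = b ^ m k"
  have "(C + 1) * \<bar>?D k\<bar> \<le> (C + 1) * (\<bar>?D 0\<bar> * int (p ^ k) ^ 2)"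
    using C(1) by (intro mult_left_mono D) simp
  also have "\<dots> < 2 ^ (p ^ k)"
    using k by (simp only: mult.assoc)
  also have "\<dots> \<le> (2::int) ^ m k"
    using n by (intro power_increasing) (simp_all add: m)
  also have "\<dots> \<le> \<bar>b\<bar> ^ m k"
    using b by (intro power_mono) simp_all
  also have "\<dots> = \<bar>B\<bar>"
    by (simp add: B_def power_abs)
  finally have small: "C * \<bar>?D k\<bar> + \<bar>?D k\<bar> < \<bar>B\<bar>"
    by (simp add: algebra_simps)
  then have "\<bar>?D k\<bar> \<le> \<bar>B\<bar>" and CD: "C * \<bar>?D k\<bar> \<le> \<bar>B\<bar>"
    using mult_nonneg_nonneg[OF C(1) abs_ge_zero[of "?D k"]] by linarith+
  then have "\<bar>?\<tau> k - int p ^ 2 * B ^ Suc q\<bar> \<le> C * \<bar>?D k\<bar> * \<bar>B\<bar> ^ q"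
    using C(2)[of "?D k + 4 * B" B] by (simp add: B_def)
  also have "\<dots> \<le> \<bar>B\<bar> * \<bar>B\<bar> ^ q"
    by (intro mult_right_mono CD) simp
  finally have close: "\<bar>?\<tau> k - int p ^ 2 * B ^ Suc q\<bar> \<le> \<bar>B\<bar> ^ Suc q"
    by simp
  have "\<bar>int p ^ 2 * B ^ Suc q\<bar> = int p ^ 2 * \<bar>B\<bar> ^ Suc q"
    by (simp add: abs_mult power_abs)
  then have "int p ^ 2 * \<bar>B\<bar> ^ Suc q - \<bar>B\<bar> ^ Suc q \<le> int p ^ 2"
    using close \<tau>[of k] by linarith
  then have "(int p ^ 2 - 1) * \<bar>B\<bar> ^ Suc q \<le> int p ^ 2"
    by (simp add: left_diff_distrib)
  moreover have "2 \<le> \<bar>B\<bar> ^ Suc q"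
  proof -
    have "m k \<noteq> 0"
      using n p by (simp add: m)
    then have "\<bar>b\<bar> ^ 1 \<le> \<bar>b\<bar> ^ (m k * Suc q)"
      using b by (intro power_increasing) simp_all
    also have "\<dots> = \<bar>B\<bar> ^ Suc q"
      by (simp only: B_def power_abs power_mult)
    finally show ?thesis
      using b by simp
  qed
  moreover have p4: "int p ^ 2 \<ge> 4"
    using power_mono[of 2 "int p" 2] p by simp
  ultimately have "(int p ^ 2 - 1) * 2 \<le> int p ^ 2"
    using mult_left_mono[of 2 "\<bar>B\<bar> ^ Suc q" "int p ^ 2 - 1"] by linarith
  then show False
    using p4 by simp
qed

text \<open>Without other prime factors x is a power of p, and the exponent is at most 2.\<close>

lemma le_square_if_only_prime_factor:
  fixes x p :: nat
  assumes "x \<noteq> 0" "prime p" "\<And>q. prime q \<Longrightarrow> q dvd x \<Longrightarrow> q = p" "\<not> p ^ 3 dvd x"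
  shows "x \<le> p\<^sup>2"
proof -
  have np: "\<not> is_unit p"
    using assms(2) not_prime_unit by blast
  obtain y where y: "x = p ^ multiplicity p x * y" "\<not> p dvd y"
    using multiplicity_decompose'[OF assms(1) np] by blast
  have "y = 1"
  proof (rule ccontr)
    assume "y \<noteq> 1"
    then obtain q where "prime q" "q dvd y"
      using prime_factor_nat by blast
    then show False
      using y assms(3)[of q] by (metis dvd_mult)
  qed
  moreover have "multiplicity p x \<le> 2"
  proof (rule ccontr)
    assume "\<not> multiplicity p x \<le> 2"
    then show False
      using assms(4) multiplicity_dvd'[of 3 p x] by simp
  qed
  ultimately show ?thesis
    using y(1) assms(2) power_increasing[of "multiplicity p x" 2 p] prime_gt_0_nat[of p] by simp
qed

section \<open>Infinitely many primes when some prime divides Q but not P\<close>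

lemma infinite_lucas_PS:
  assumes disc: "lucas_disc P Q \<noteq> 1" and "Q \<noteq> 0"
    and l: "prime l" "int l dvd Q" "\<not> int l dvd P"
  shows "infinite (lucas_PS P Q)"
proof
  assume fin: "finite (lucas_PS P Q)"
  define d where "d = gcd (P\<^sup>2) Q"
  have "d \<noteq> 0"
    using \<open>Q \<noteq> 0\<close> by (simp add: d_def)
  then obtain a b where ab: "P\<^sup>2 = d * a" "Q = d * b" "coprime a b"
    using gcd_coprime_exists[of "P\<^sup>2" Q] unfolding d_def by (metis mult.commute)
  \<comment> \<open>Since l does not divide P, it is not absorbed by d; it divides b, whence |b| >=
    2.\<close>
  have "\<not> int l dvd d"
    using l prime_dvd_power_int[of "int l" P 2] unfolding d_def by auto
  then have "int l dvd b"
    using l ab(2) by (simp add: prime_dvd_mult_iff)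
  moreover have "b \<noteq> 0"
    using \<open>Q \<noteq> 0\<close> ab(2) by simp
  ultimately have "int l \<le> \<bar>b\<bar>"
    using zdvd_imp_le[of "int l" "\<bar>b\<bar>"] by simp
  then have b2: "\<bar>b\<bar> \<ge> 2"
    using prime_ge_2_nat[OF l(1)] by linarith

  let ?t = "lehmer_sq a b"
  have u_t: "(lucas_u P Q (Suc n))\<^sup>2 = d ^ n * ?t (Suc n)" for n
    using lehmer_sq_scale[of d a b "Suc n"] \<open>d \<noteq> 0\<close> unfolding lucas_u_sq ab(1,2)[symmetric] by simp
  \<comment> \<open>Modulo l, u_n is a power of P and therefore nonzero.\<close>
  have t_nz: "?t n \<noteq> 0" if "n > 0" for n
  proof -
    obtain n' where n': "n = Suc n'"
      using gr0_implies_Suc[OF \<open>n > 0\<close>] by blast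
    have "[lucas_u P Q n = P ^ n'] (mod int l)"
      unfolding n' using lucas_u_cong_Q l(2) cong_dvd_modulus by blast
    then have "int l dvd lucas_u P Q n \<longleftrightarrow> int l dvd P ^ n'"
      by (rule cong_dvd_iff)
    then have "\<not> int l dvd lucas_u P Q n"
      using l(1,3) prime_dvd_power_int[of "int l" P n'] by auto
    then show ?thesis
      using u_t[of n'] n' by auto
  qed
  have t_u: "int q dvd lucas_u P Q n" if "prime q" "n > 0" "int q dvd ?t n" for q n
  proof -
    obtain n' where n': "n = Suc n'"
      using gr0_implies_Suc[OF \<open>n > 0\<close>] by blast
    have "int q dvd (lucas_u P Q n)\<^sup>2"
      unfolding n' u_t using that n' by simp
    then show ?thesis
      using that(1) prime_dvd_power_int prime_nat_int_transfer by blast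
  qed
  \<comment> \<open>Modulo a prime dividing b, t_n is a power of a, and a is coprime to b.\<close>
  have t_b: "\<not> int q dvd b" if "prime q" "n > 0" "int q dvd ?t n" for q n
  proof
    assume *: "int q dvd b"
    obtain n' where n': "n = Suc n'"
      using gr0_implies_Suc[OF \<open>n > 0\<close>] by blast
    have "[?t n = a ^ n'] (mod int q)"
      unfolding n' using lehmer_sq_cong_b * cong_dvd_modulus by blast
    then have "int q dvd ?t n \<longleftrightarrow> int q dvd a ^ n'"
      by (rule cong_dvd_iff)
    then have "int q dvd a"
      using that prime_dvd_power_int[of "int q" a n'] by simp
    then show False
      using * ab(3) that(1) by (metis not_coprimeI not_prime_unit prime_nat_int_transfer)
  qed
  have t_dvd: "?t n dvd ?t n'" if "n dvd n'" for n n'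
    using that lehmer_sq_mult[of a b n] by (auto elim!: dvdE)

  obtain p where p: "prime p" "p \<in> lucas_S P Q"
    using prime_dvd_lucas_disc_in_lucas_S[OF disc] by blast
  define T where "T = {q. prime q \<and> (\<exists>n\<in>lucas_S P Q. int q dvd ?t n)}"
  have "T \<subseteq> lucas_PS P Q"
  proof
    fix q assume "q \<in> T"
    then obtain n where "prime q" "n \<in> lucas_S P Q" "int q dvd ?t n"
      by (auto simp: T_def)
    then show "q \<in> lucas_PS P Q"
      using t_u[OF _ lucas_S_pos] by (intro prime_in_lucas_PS dvd_mult) auto
  qed
  then have "finite T"
    using fin finite_subset by blast
  moreover have "T \<subseteq> T" by simp
  \<comment> \<open>Finitely many indices are merged by lcm, since t_k divides t_l whenever k
    divides l. Starting from p makes p divide n, so that powers of p may be multiplied in.\<close>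
  ultimately have "\<exists>n\<in>lucas_S P Q. p dvd n \<and> (\<forall>q\<in>T. int q dvd ?t n)"
  proof (induction rule: finite_subset_induct')
    case empty
    then show ?case
      using p by (auto intro!: bexI[of _ p])
  next
    case (insert q F)
    then obtain n where n: "n \<in> lucas_S P Q" "p dvd n" "\<And>q. q \<in> F \<Longrightarrow> int q dvd ?t n"
      by blast
    obtain n' where n': "n' \<in> lucas_S P Q" "int q dvd ?t n'"
      using insert by (auto simp: T_def)
    show ?case
    proof (intro bexI[of _ "lcm n n'"] conjI ballI)
      show "lcm n n' \<in> lucas_S P Q"
        using n n' lucas_S_lcm by blast
      show "p dvd lcm n n'"
        using n(2) by (rule dvd_lcmI1)
      show "int r dvd ?t (lcm n n')" if "r \<in> insert q F" for r
        using that n(3) n'(2) t_dvd[of n "lcm n n'"] t_dvd[of n' "lcm n n'"] by (auto intro: dvd_trans)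
    qed
  qed
  then obtain n where n: "n \<in> lucas_S P Q" "p dvd n" "\<And>q. q \<in> T \<Longrightarrow> int q dvd ?t n"
    by blast
  have "int p dvd lucas_u P Q n"
    using n(1,2) dvd_trans[of "int p" "int n"] by (simp add: lucas_S_def)
  then have nS: "n * p ^ k \<in> lucas_S P Q" for k
    by (intro lucas_S_mult_prime_power n p) simp
  \<comment> \<open>\<open>?\<tau> k\<close> is the quotient of t at n p^(k+1) by t at n p^k, and
    \<open>?D k\<close> is the discriminant of its parameters.\<close>
  let ?D = "\<lambda>k. (a - 4 * b) * ?t (n * p ^ k)"
  let ?\<tau> = "\<lambda>k. lehmer_sq (?D k + 4 * b ^ (n * p ^ k)) (b ^ (n * p ^ k)) p"
  have \<tau>: "?t (n * p ^ Suc k) = ?t (n * p ^ k) * ?\<tau> k" for k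
    using lehmer_sq_mult[of a b "n * p ^ k" p] by (simp add: mult_ac)
  have \<tau>_cong: "[?\<tau> k = int p ^ 2 * (b ^ (n * p ^ k)) ^ (p - 1)] (mod ?D k)" for k
    using lehmer_sq_cong_disc[of "?D k + 4 * b ^ (n * p ^ k)" "b ^ (n * p ^ k)" "p - 1"]
      prime_gt_0_nat[OF p(1)] by simp
  have T_D: "int q dvd ?D k" if "q \<in> T" for q k
    using n(3)[OF that] t_dvd[of n "n * p ^ k"] by (auto intro: dvd_trans)
  \<comment> \<open>A prime q dividing the quotient lies in T and so divides \<open>?D k\<close>;
    modulo q the quotient is p^2 times a power of b, and q does not divide b.\<close>
  have prime_\<tau>: "q \<in> T" "q = p" if q: "prime q" "int q dvd ?\<tau> k" for q k
  proof -
    have "int q dvd ?t (n * p ^ Suc k)"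
      using q \<tau> by simp
    then show "q \<in> T"
      using q nS unfolding T_def by blast
    then have "int q dvd ?D k"
      by (rule T_D)
    then have "int q dvd int p ^ 2 * (b ^ (n * p ^ k)) ^ (p - 1)"
      using q(2) cong_dvd_iff cong_dvd_modulus[OF \<tau>_cong] by blast
    moreover have "\<not> int q dvd b"
      using q(1) \<open>int q dvd ?t (n * p ^ Suc k)\<close> t_b lucas_S_pos[OF nS] by blast
    ultimately have "int q dvd int p"
      using q(1) by (auto simp: prime_dvd_mult_iff dest!: prime_dvd_power_int[rotated])
    then show "q = p"
      using p(1) q(1) primes_dvd_imp_eq by simp
  qed
  \<comment> \<open>Every quotient is divisible by p once p lies in T, so each step contributes a
    factor p.\<close>
  have p_D: "int p ^ k dvd ?D k" if "p \<in> T" for k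
  proof (induction k)
    case (Suc k)
    have "[?\<tau> k = int p ^ 2 * (b ^ (n * p ^ k)) ^ (p - 1)] (mod int p)"
      using \<tau>_cong T_D[OF that] cong_dvd_modulus by blast
    then have "int p dvd ?\<tau> k"
      by (subst cong_dvd_iff) auto
    then show ?case
      unfolding \<tau> using mult_dvd_mono[OF Suc, of "int p" "?\<tau> k"] by (simp only: mult_ac power_Suc)
  qed simp
  have "\<bar>?\<tau> k\<bar> \<le> int p ^ 2" if "k \<ge> 3" for k
  proof -
    \<comment> \<open>For k >= 3 the modulus \<open>?D k\<close> is divisible by p^3 if p lies in T,
      and p^2 times a power of b is not.\<close>
    have "\<not> int p ^ 3 dvd ?\<tau> k"
    proof
      assume *: "int p ^ 3 dvd ?\<tau> k"
      then have "int p dvd ?\<tau> k"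
        by (metis dvd_power_same dvd_trans dvd_triv_left power3_eq_cube mult.assoc)
      then have "p \<in> T" and pb: "\<not> int p dvd b"
        using prime_\<tau> p(1) t_b[OF p(1) lucas_S_pos[OF nS], of "Suc k"] \<tau>[of k] by auto
      then have "int p ^ 3 dvd ?D k"
        using p_D[of k] le_imp_power_dvd[OF that, of "int p"] dvd_trans by blast
      then have "int p ^ 3 dvd int p ^ 2 * (b ^ (n * p ^ k)) ^ (p - 1)"
        using * cong_dvd_iff cong_dvd_modulus[OF \<tau>_cong] by blast
      then have "int p dvd (b ^ (n * p ^ k)) ^ (p - 1)"
        using prime_gt_0_nat[OF p(1)] by (simp add: power3_eq_cube power2_eq_square mult.assoc)
      then show False
        using pb p(1) by (auto dest!: prime_dvd_power_int[rotated])
    qed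
    moreover have "?\<tau> k \<noteq> 0"
      using \<tau>[of k] t_nz[OF lucas_S_pos[OF nS], of "Suc k"] by auto
    ultimately have "nat \<bar>?\<tau> k\<bar> \<le> p\<^sup>2"
      using prime_\<tau>(2) p(1) by (intro le_square_if_only_prime_factor) (auto simp: nat_abs_dvd_iff)
    then show ?thesis
      by (simp add: nat_le_iff)
  qed
  \<comment> \<open>The bound is available from k = 3 on, so the growth lemma is started at n
    p^3.\<close>
  then have "\<not> \<bar>?\<tau> (3 + k)\<bar> > int p ^ 2" for k
    by (simp add: not_less)
  moreover have "n * p ^ 3 * p ^ k = n * p ^ (3 + k)" for k
    by (simp only: power_add mult.assoc)
  then have "\<exists>k. \<bar>?\<tau> (3 + k)\<bar> > int p ^ 2"
    using lehmer_sq_quotient_large[OF prime_gt_1_nat[OF p(1)] lucas_S_pos[OF nS[of 3]] b2 refl, of a]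
    by (simp only:)
  ultimately show False
    by blast
qed

theorem theorem23:
  fixes P Q :: int
  shows "(finite (lucas_S P Q) \<longleftrightarrow> lucas_disc P Q = 1)
    \<and> (finite (lucas_S P Q) \<longrightarrow> lucas_S P Q = {1})
    \<and> (infinite (lucas_S P Q) \<and> (Q = 0 \<and> P \<noteq> 0) \<longrightarrow>
         finite (lucas_PS P Q) \<and> lucas_PS P Q = {p::nat. prime p \<and> int p dvd P})
    \<and> (infinite (lucas_S P Q) \<and> \<not> (Q = 0 \<and> P \<noteq> 0) \<longrightarrow> infinite (lucas_PS P Q))
    \<and> (lucas_PS P Q = {p::nat. prime p} \<longleftrightarrow>
         (\<forall>p::nat. prime p \<and> int p dvd Q \<longrightarrow> special_prime P Q p))
    \<and> (Q = 1 \<or> Q = -1 \<longrightarrow> lucas_PS P Q = {p::nat. prime p})"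
proof -
  have fin: "finite (lucas_S P Q) \<longleftrightarrow> lucas_disc P Q = 1"
    using infinite_lucas_S lucas_S_disc_1 by (metis finite.emptyI finite_insert)
  have Q0: "finite (lucas_PS P Q) \<and> lucas_PS P Q = {p. prime p \<and> int p dvd P}" if "Q = 0" "P \<noteq> 0"
  proof
    \<comment> \<open>For Q = 0 every prime divides Q, and being special amounts to dividing
      P.\<close>
    have "special_prime P Q p" if "p \<in> lucas_PS P Q" for p
      using that \<open>Q = 0\<close> special_prime_if_in_lucas_PS by simp
    moreover have "p \<in> lucas_PS P Q" if "prime p" "int p dvd P" for p
      using that \<open>Q = 0\<close> special_prime_in_lucas_S prime_in_lucas_S_in_lucas_PS
      by (simp add: special_prime_def)
    ultimately show eq: "lucas_PS P Q = {p. prime p \<and> int p dvd P}"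
      by (auto simp: special_prime_def)
    have "{p. prime p \<and> int p dvd P} \<subseteq> {..nat \<bar>P\<bar>}"
      using dvd_imp_le_int[OF \<open>P \<noteq> 0\<close>, of "int _"] by (auto simp: le_nat_iff)
    then show "finite (lucas_PS P Q)"
      unfolding eq using finite_subset by blast
  qed
  have all: "lucas_PS P Q = {p. prime p} \<longleftrightarrow> (\<forall>p. prime p \<and> int p dvd Q \<longrightarrow> special_prime P Q p)"
  proof
    assume "lucas_PS P Q = {p. prime p}"
    then show "\<forall>p. prime p \<and> int p dvd Q \<longrightarrow> special_prime P Q p"
      using special_prime_if_in_lucas_PS by blast
  next
    assume "\<forall>p. prime p \<and> int p dvd Q \<longrightarrow> special_prime P Q p"
    then have "{p. prime p} \<subseteq> lucas_PS P Q"
      using prime_in_lucas_PS_if_all_special by blast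
    moreover have "lucas_PS P Q \<subseteq> {p. prime p}"
      by (auto simp: lucas_PS_def)
    ultimately show "lucas_PS P Q = {p. prime p}"
      by blast
  qed
  have inf: "infinite (lucas_PS P Q)" if "lucas_disc P Q \<noteq> 1" "\<not> (Q = 0 \<and> P \<noteq> 0)"
  proof (cases "\<forall>p. prime p \<and> int p dvd Q \<longrightarrow> special_prime P Q p")
    case True
    then show ?thesis
      using all primes_infinite by simp
  next
    case False
    then obtain l where l: "prime l" "int l dvd Q" "\<not> int l dvd P"
      by (auto simp: special_prime_def)
    \<comment> \<open>P is nonzero because l does not divide it, so Q = 0 would be the excluded
      case.\<close>
    then have "Q \<noteq> 0"
      using that(2) by auto
    then show ?thesis
      using infinite_lucas_PS[OF that(1) _ l] by blast
  qed
  have "lucas_PS P Q = {p. prime p}" if "Q = 1 \<or> Q = -1"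
    using that unfolding all by (auto dest: prime_gt_1_nat)
  then show ?thesis
    using fin lucas_S_disc_1 Q0 inf all by blast
qed

end
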